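(* Let $G$ be a group and $k\geq 1$ an integer, let $F(G,k)=\{(g_1,\ldots,g_k)\in G^k : g_i\neq g_j \text{ for } i\neq j\}$, and consider the Cayley graph $Cay(G^k,F(G,k))$. (1) If $k=2$, or if $|G|\geq k+1\geq 4$, then $Cay(G^k,F(G,k))$ is path-connected. (2) If $G$ is abelian and finite with $|G|=k\geq 3$, then $Cay(G^k,F(G,k))$ is not path-connected.
   Context: For a group $\Gamma$ and a subset $S\subset\Gamma\setminus\{1\}$, the Cayley graph $Cay(\Gamma,S)$ has vertex set $\Gamma$ and edge set $\{(x,y) : x^{-1}y\in S\}$. A path from $x_1$ to $x_m$ is a sequence of distinct vertices $[x_1,\ldots,x_m]$ with each $(x_i,x_{i+1})$ an edge (a single vertex is allowed); the graph is path-connected if any two vertices are joined by a path. *)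

theory Defs
  imports
    "HOL-Algebra.Product_Groups"
    "Graph_Theory.Pair_Digraph"
    "Graph_Theory.Vertex_Walk"
begin

definition cayley_graph :: "('a, 'c) monoid_scheme \<Rightarrow> 'a set \<Rightarrow> 'a pair_pre_digraph"
  where "cayley_graph \<Gamma> S =
    \<lparr> pverts = carrier \<Gamma>,
      parcs = {(x, y). x \<in> carrier \<Gamma> \<and> y \<in> carrier \<Gamma> \<and> inv\<^bsub>\<Gamma>\<^esub> x \<otimes>\<^bsub>\<Gamma>\<^esub> y \<in> S} \<rparr>"

text \<open>The library's \<^const>\<open>vpath\<close> is a nonempty list of distinct vertices whose consecutive
  entries are joined by arcs; a single vertex is allowed.\<close>

definition path_connected_graph :: "('a, 'b) pre_digraph \<Rightarrow> bool"
  where "path_connected_graph X \<longleftrightarrow>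
    (\<forall>x\<in>verts X. \<forall>y\<in>verts X. \<exists>p. vpath p X \<and> hd p = x \<and> last p = y)"

definition group_power :: "('a, 'c) monoid_scheme \<Rightarrow> nat \<Rightarrow> (nat \<Rightarrow> 'a) monoid"
  where "group_power G k = product_group {1..k} (\<lambda>_. G)"

definition config_space :: "('a, 'c) monoid_scheme \<Rightarrow> nat \<Rightarrow> (nat \<Rightarrow> 'a) set"
  where "config_space G k =
    {g \<in> carrier (group_power G k). \<forall>i\<in>{1..k}. \<forall>j\<in>{1..k}. i \<noteq> j \<longrightarrow> g i \<noteq> g j}"

end

theory Submission
  imports Defs "HOL-Algebra.FiniteProduct"
begin

text \<open>Changing a single coordinate \<open>i\<close> of a tuple multiplies it by some \<open>c \<noteq> 1\<close> placed in slot \<open>i\<close>.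
  For \<open>k = 2\<close> that multiplier \<open>(c, 1)\<close> is itself a configuration, hence an edge. If the group has
  at least \<open>k + 1\<close> elements, it is the quotient of two configurations that agree outside slot \<open>i\<close>
  and have the entries \<open>1\<close> and \<open>c\<close> in it, so the change takes two edges. Changing the coordinates
  one after the other connects any two tuples.

  If the group is abelian of order \<open>k\<close>, every configuration enumerates the whole group, so each edge
  multiplies the product of the coordinates by the same element \<open>P\<close>, the product of all group
  elements, and \<open>P\<^sup>2 = 1\<close>. From the identity only tuples with product \<open>1\<close> or \<open>P\<close> are reached, whereas
  the products take at least three values.\<close>

lemma verts_cayley_graph [simp]: "pverts (cayley_graph \<Gamma> S) = carrier \<Gamma>"
  by (simp add: cayley_graph_def)

text \<open>Any walk can be shortened to one with distinct vertices, so the distinctness demanded of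
  a path costs nothing. From here on, connectivity is plain reachability along arcs.\<close>

lemma path_connected_graph_cayley_graph_iff:
  "path_connected_graph (with_proj (cayley_graph \<Gamma> S)) \<longleftrightarrow>
    (\<forall>x\<in>carrier \<Gamma>. \<forall>y\<in>carrier \<Gamma>. (x, y) \<in> (parcs (cayley_graph \<Gamma> S))\<^sup>*)"
proof -
  interpret wf_digraph "with_proj (cayley_graph \<Gamma> S)"
    by unfold_locales (auto simp: cayley_graph_def)
  show ?thesis
    by (auto simp: path_connected_graph_def reachable_vpath_conv [symmetric] reachable_conv)
qed

lemma carrier_group_power [simp]: "carrier (group_power G k) = (\<Pi>\<^sub>E i\<in>{1..k}. carrier G)"
  by (simp add: group_power_def)

lemma config_space_iff:
  "g \<in> config_space G k \<longleftrightarrow> g \<in> (\<Pi>\<^sub>E i\<in>{1..k}. carrier G) \<and> inj_on g {1..k}"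
  by (auto simp: config_space_def inj_on_def)

lemma ex_inj_on_into_large_set:
  assumes "finite A" and "infinite B \<or> card A \<le> card B"
  shows "\<exists>f. inj_on f A \<and> f ` A \<subseteq> B"
proof -
  obtain C where "C \<subseteq> B" "finite C" "card C = card A"
    using assms by (metis infinite_arbitrarily_large obtain_subset_with_card_n)
  then show ?thesis
    using assms by (metis finite_same_card_bij bij_betw_def)
qed

context group
begin

text \<open>Inverses and products in the power are formed coordinatewise, so membership of the
  quotient in \<open>config_space\<close> comes down to injectivity of its coordinate
  function.\<close>

lemma arc_config_space_iff:
  "(x, y) \<in> parcs (cayley_graph (group_power G k) (config_space G k)) \<longleftrightarrow>
    x \<in> (\<Pi>\<^sub>E i\<in>{1..k}. carrier G) \<and> y \<in> (\<Pi>\<^sub>E i\<in>{1..k}. carrier G) \<and>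
    inj_on (\<lambda>i. inv (x i) \<otimes> y i) {1..k}"
  (is "?L \<longleftrightarrow> ?x \<and> ?y \<and> ?inj")
proof (cases "?x \<and> ?y")
  case True
  define g where "g = inv\<^bsub>group_power G k\<^esub> x \<otimes>\<^bsub>group_power G k\<^esub> y"
  have g: "g = (\<lambda>i\<in>{1..k}. inv (x i) \<otimes> y i)"
    using True by (auto simp: g_def group_power_def is_group fun_eq_iff)
  have "g \<in> (\<Pi>\<^sub>E i\<in>{1..k}. carrier G)"
    using True by (auto simp: g PiE_iff)
  moreover have "inj_on g {1..k} \<longleftrightarrow> ?inj"
    by (rule inj_on_cong) (simp add: g)
  ultimately show ?thesis
    using True by (simp add: cayley_graph_def config_space_iff flip: g_def)
next
  case False
  then show ?thesis by (auto simp: cayley_graph_def)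
qed

lemma config_space_one_coordinate:
  assumes k: "k = 2 \<or> infinite (carrier G) \<or> card (carrier G) \<ge> k + 1"
    and i: "i \<in> {1..k}"
    and x: "x \<in> (\<Pi>\<^sub>E i\<in>{1..k}. carrier G)"
    and b: "b \<in> carrier G"
  shows "(x, x(i := b)) \<in> (parcs (cayley_graph (group_power G k) (config_space G k)))\<^sup>*"
    (is "_ \<in> ?E\<^sup>*")
proof (cases "b = x i")
  case True
  then show ?thesis by simp
next
  case False
  define c where "c = inv (x i) \<otimes> b"
  have xi: "x j \<in> carrier G" if "j \<in> {1..k}" for j
    using x that by blast
  have c: "c \<in> carrier G" "c \<noteq> \<one>"
    using False i xi b inv_equality inv_inv unfolding c_def
    by (auto, metis inv_closed inv_inv inv_unique' inv_comm)
  have y: "x(i := b) \<in> (\<Pi>\<^sub>E i\<in>{1..k}. carrier G)"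
    using x i b by (auto simp: PiE_iff extensional_def)
  show ?thesis
  proof (cases "k = 2")
    case True
    have "(x, x(i := b)) \<in> ?E"
      unfolding arc_config_space_iff
      using x y c xi i by (auto simp: True inj_on_def c_def)
    then show ?thesis by blast
  next
    case False
    \<comment> \<open>Since \<open>c\<close> differs from the identity, exactly two elements are
      removed. In the finite case at least k - 1 remain, one for each slot other than
      \<open>i\<close>.\<close>
    have "infinite (carrier G - {\<one>, c}) \<or> card ({1..k} - {i}) \<le> card (carrier G - {\<one>, c})"
      using k False i c by (auto simp: card_Diff_subset)
    then obtain f where f: "inj_on f ({1..k} - {i})" "f ` ({1..k} - {i}) \<subseteq> carrier G - {\<one>, c}"
      using ex_inj_on_into_large_set [of "{1..k} - {i}" "carrier G - {\<one>, c}"] by auto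
    have fC: "f j \<in> carrier G" "f j \<noteq> \<one>" "f j \<noteq> c" if "j \<in> {1..k}" "j \<noteq> i" for j
      using f(2) that by (auto simp: image_subset_iff)
    \<comment> \<open>The midpoint keeps slot \<open>i\<close> and twists every other slot by the
      inverse of \<open>f j\<close>. The first edge is then the inverse of (identity in slot
      \<open>i\<close>, \<open>f\<close> elsewhere), and the second undoes the twist while putting
      \<open>c\<close> in slot \<open>i\<close>.\<close>
    define z where "z = (\<lambda>j\<in>{1..k}. if j = i then x i else x j \<otimes> inv (f j))"
    have z: "z \<in> (\<Pi>\<^sub>E i\<in>{1..k}. carrier G)"
      using xi fC by (auto simp: z_def)
    have 1: "inv (x j) \<otimes> z j = inv (if j = i then \<one> else f j)" if "j \<in> {1..k}" for j
      using that xi fC by (auto simp: z_def simp flip: m_assoc)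
    have 2: "inv (z j) \<otimes> (x(i := b)) j = (if j = i then c else f j)" if "j \<in> {1..k}" for j
      using that xi fC by (auto simp: z_def c_def inv_mult_group m_assoc)
    have "inj_on (\<lambda>j. inv (if j = i then \<one> else f j)) {1..k}"
    proof (rule inj_onI)
      fix j l assume "j \<in> {1..k}" "l \<in> {1..k}"
        and "inv (if j = i then \<one> else f j) = inv (if l = i then \<one> else f l)"
      moreover from this have "(if j = i then \<one> else f j) = (if l = i then \<one> else f l)"
        using fC inv_inj by (auto dest: inj_onD)
      ultimately show "j = l"
        using fC f(1) by (auto split: if_splits dest: inj_onD)
    qed
    then have "inj_on (\<lambda>j. inv (x j) \<otimes> z j) {1..k}"
      by (rule inj_on_cong [THEN iffD1, rotated]) (rule 1 [symmetric])
    then have "(x, z) \<in> ?E"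
      unfolding arc_config_space_iff using x z by blast
    moreover have "inj_on (\<lambda>j. if j = i then c else f j) {1..k}"
      by (rule inj_onI) (use f(1) fC in \<open>auto split: if_splits dest: inj_onD\<close>)
    then have "inj_on (\<lambda>j. inv (z j) \<otimes> (x(i := b)) j) {1..k}"
      by (rule inj_on_cong [THEN iffD1, rotated]) (rule 2 [symmetric])
    then have "(z, x(i := b)) \<in> ?E"
      unfolding arc_config_space_iff using y z by blast
    ultimately show ?thesis by auto
  qed
qed

theorem config_space_path_connected:
  assumes k: "k = 2 \<or> infinite (carrier G) \<or> card (carrier G) \<ge> k + 1"
  shows "path_connected_graph (with_proj (cayley_graph (group_power G k) (config_space G k)))"
  unfolding path_connected_graph_cayley_graph_iff carrier_group_power
proof (intro ballI)
  fix x y assume x: "x \<in> (\<Pi>\<^sub>E i\<in>{1..k}. carrier G)" and y: "y \<in> (\<Pi>\<^sub>E i\<in>{1..k}. carrier G)"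
  \<comment> \<open>The tuple \<open>override_on x y A\<close> has already been switched to
    \<open>y\<close> on the slots in \<open>A\<close>; enlarging \<open>A\<close> by one slot is a
    change of one coordinate.\<close>
  have *: "(x, override_on x y A) \<in> (parcs (cayley_graph (group_power G k) (config_space G k)))\<^sup>*"
    if "finite A" "A \<subseteq> {1..k}" for A
    using that
  proof (induction A rule: finite_induct)
    case empty
    then show ?case by simp
  next
    case (insert i A)
    have "override_on x y A \<in> (\<Pi>\<^sub>E i\<in>{1..k}. carrier G)"
      using x y by (auto simp: PiE_iff extensional_def override_on_def)
    moreover have "i \<in> {1..k}" "y i \<in> carrier G"
      using insert.prems y by auto
    ultimately show ?case
      using config_space_one_coordinate [OF k, of i "override_on x y A" "y i"] insert
      by (auto simp: override_on_insert simp del: One_nat_def fun_upd_apply intro: rtrancl_trans)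
  qed
  have "override_on x y {1..k} = y"
    using x y by (auto simp: override_on_def PiE_iff extensional_def)
  then show "(x, y) \<in> (parcs (cayley_graph (group_power G k) (config_space G k)))\<^sup>*"
    using * [of "{1..k}"] by simp
qed

end

context comm_group
begin

text \<open>Inversion permutes the group, so the product of all elements equals the product of all
  inverses; multiplying the two termwise cancels everything.\<close>

lemma finprod_carrier_square:
  "finprod G (\<lambda>x. x) (carrier G) \<otimes> finprod G (\<lambda>x. x) (carrier G) = \<one>"
proof -
  have "finprod G (\<lambda>x. x) (carrier G) = finprod G (\<lambda>x. x) ((\<lambda>x. inv x) ` carrier G)"
    by (metis (no_types, lifting) inv_closed inv_inv image_iff subsetI image_subsetI subset_antisym)
  also have "\<dots> = finprod G (\<lambda>x. inv x) (carrier G)"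
    by (rule finprod_reindex) (auto simp: inv_inj)
  finally have "finprod G (\<lambda>x. x) (carrier G) \<otimes> finprod G (\<lambda>x. x) (carrier G)
      = finprod G (\<lambda>x. x \<otimes> inv x) (carrier G)"
    by (simp add: finprod_multf)
  also have "\<dots> = \<one>"
    by (rule finprod_one_eqI) simp
  finally show ?thesis .
qed

lemma finprod_arc_config_space:
  assumes "finite (carrier G)" and "card (carrier G) = k"
    and "(x, y) \<in> parcs (cayley_graph (group_power G k) (config_space G k))"
  shows "finprod G y {1..k} = finprod G x {1..k} \<otimes> finprod G (\<lambda>x. x) (carrier G)"
proof -
  define g where "g = (\<lambda>i. inv (x i) \<otimes> y i)"
  have x: "x \<in> {1..k} \<rightarrow> carrier G" and y: "y \<in> {1..k} \<rightarrow> carrier G" and inj: "inj_on g {1..k}"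
    using assms(3) unfolding arc_config_space_iff g_def by auto
  then have g: "g \<in> {1..k} \<rightarrow> carrier G"
    by (auto simp: g_def)
  \<comment> \<open>An injective image of k indices inside a group of order k is the whole
    group.\<close>
  have "g ` {1..k} = carrier G"
    using g inj assms by (intro card_subset_eq) (auto simp: card_image)
  then have "finprod G g {1..k} = finprod G (\<lambda>x. x) (carrier G)"
    using finprod_reindex [OF _ inj, of "\<lambda>x. x"] by auto
  moreover have "finprod G y {1..k} = finprod G (\<lambda>i. x i \<otimes> g i) {1..k}"
    using x y g by (intro finprod_cong') (auto simp: g_def Pi_iff simp flip: m_assoc)
  ultimately show ?thesis
    using x g by simp
qed

theorem config_space_not_path_connected:
  assumes fin: "finite (carrier G)" and card: "card (carrier G) = k" and k: "k \<ge> 3"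
  shows "\<not> path_connected_graph (with_proj (cayley_graph (group_power G k) (config_space G k)))"
proof
  assume conn: "path_connected_graph (with_proj (cayley_graph (group_power G k) (config_space G k)))"
  define P where "P = finprod G (\<lambda>x. x) (carrier G)"
  have P: "P \<in> carrier G" "P \<otimes> P = \<one>"
    using finprod_carrier_square by (auto simp: P_def)
  have "\<not> carrier G \<subseteq> {\<one>, P}"
    using card k card_mono [of "{\<one>, P}" "carrier G"] by (auto simp: card_insert_if split: if_splits)
  then obtain a where a: "a \<in> carrier G" "a \<noteq> \<one>" "a \<noteq> P"
    by blast
  \<comment> \<open>The identity tuple has product 1, and a single entry \<open>a\<close> gives a
    tuple with product \<open>a\<close>, outside the reachable values.\<close>
  define x y where "x = (\<lambda>i\<in>{1..k}. \<one>)" and "y = (\<lambda>i\<in>{1..k}. if i = 1 then a else \<one>)"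
  have x: "finprod G x {1..k} = \<one>"
    by (rule finprod_one_eqI) (simp add: x_def)
  have "finprod G y {1..k} = finprod G (\<lambda>i. if i = 1 then a else \<one>) {1..k}"
    using a by (intro finprod_cong') (auto simp: y_def)
  also have "\<dots> = a"
    using finprod_singleton_swap [of 1 "{1..k}" "\<lambda>_. a"] k a by simp
  finally have y: "finprod G y {1..k} = a" .
  have "x \<in> (\<Pi>\<^sub>E i\<in>{1..k}. carrier G)" "y \<in> (\<Pi>\<^sub>E i\<in>{1..k}. carrier G)"
    using a by (auto simp: x_def y_def)
  with conn have "(x, y) \<in> (parcs (cayley_graph (group_power G k) (config_space G k)))\<^sup>*"
    by (simp add: path_connected_graph_cayley_graph_iff)
  \<comment> \<open>The invariant survives each edge because multiplication by \<open>P\<close>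
    swaps the identity and \<open>P\<close>.\<close>
  then have "finprod G y {1..k} \<in> {\<one>, P}"
  proof (induction rule: rtrancl_induct)
    case base
    show ?case by (simp only: x insertI1)
  next
    case (step y z)
    then show ?case
      using P finprod_arc_config_space [OF fin card step.hyps(2), folded P_def] by auto
  qed
  with y a show False by simp
qed

end

theorem theorem4p1:
  fixes G :: "('a, 'c) monoid_scheme" and k :: nat
  assumes "group G" and "k \<ge> 1"
  shows "(k = 2 \<or> ((infinite (carrier G) \<or> card (carrier G) \<ge> k + 1) \<and> k + 1 \<ge> 4) \<longrightarrow>
           path_connected_graph (with_proj (cayley_graph (group_power G k) (config_space G k))))
       \<and> (comm_group G \<and> finite (carrier G) \<and> card (carrier G) = k \<and> k \<ge> 3 \<longrightarrow>
           \<not> path_connected_graph (with_proj (cayley_graph (group_power G k) (config_space G k))))"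
  using group.config_space_path_connected [OF assms(1), of k]
    comm_group.config_space_not_path_connected [of G k] by blast

end
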